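(* Let $n,m\ge 1$ and let $F:\mathbb{R}_{+}^{n}\rightrightarrows \mathbb{R}_{+}^{m}$ be a set-valued mapping. Then $F$ is ICR (increasing and co-radiant), takes only normal values and has a closed graph if, and only if, there exists a set $A\in\mathcal{A}$ such that $$F=\bigcap_{(x,y)\in (\mathbb{R}_{+}^{n}\times \mathbb{R}_{+}^{m})\setminus A}E_{A,(x,y)},$$ where the intersection is pointwise, i.e. $F(u)=\bigcap_{(x,y)\in (\mathbb{R}_{+}^{n}\times \mathbb{R}_{+}^{m})\setminus A}E_{A,(x,y)}(u)$ for every $u\in\mathbb{R}_+^n$. Namely, if $F$ is ICR, takes only normal values and has a closed graph, one can take $A:=gr(F)$.
   Context: $\mathbb{R}_{+}^{n}$ is the nonnegative orthant of $\mathbb{R}^n$; $x\le y$ is the componentwise order. A set-valued mapping $F:\mathbb{R}_{+}^{n}\rightrightarrows \mathbb{R}_{+}^{m}$ assigns to each $x\in\mathbb{R}_+^n$ a (possibly empty) subset $F(x)\subset\mathbb{R}_+^m$; its graph is $gr(F)=\{(x,y)\in\mathbb{R}_+^n\times\mathbb{R}_+^m: y\in F(x)\}$. Sums of sets are Minkowski sums. An intersection over an empty family of mappings is the mapping with constant value $\mathbb{R}_+^m$. $F$ is increasing if $x\le y$ implies $F(x)\subset F(y)$. $F$ is co-radiant if its graph is nonempty and $F(tx)\supset tF(x)$ for all $x\in\mathbb{R}_+^n$, $t\in(0,1]$. ICR means increasing and co-radiant. A set $C\subset\mathbb{R}_+^m$ is normal if $x\in C$, $0\le y\le x$ imply $y\in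 C$ (the empty set is normal). A nonempty set $C\subset\mathbb{R}_+^p$ is radiant if $x\in C$, $t\in(0,1]$ imply $tx\in C$. $\mathcal{A}$ denotes the class of nonempty closed radiant sets $A\subset\mathbb{R}_+^n\times\mathbb{R}_+^m$ such that $A+\mathbb{R}_+^n\times\{0\}=A$ and $\left(A+\{0\}\times(-\mathbb{R}_+^m)\right)\cap(\mathbb{R}_+^n\times\mathbb{R}_+^m)=A$. Put $p:=n+m$ and identify $\mathbb{R}_+^n\times\mathbb{R}_+^m$ with $\mathbb{R}_+^p$; $e_1,\dots,e_p$ are the unit vectors of $\mathbb{R}^p$. For a nonempty closed set $A\subset\mathbb{R}_+^p$ and $z\in\mathbb{R}_+^p\setminus A$, let $I_+(z):=\{i\in\{1,\dots,p\}: z_i>0\}$, $r_{A,z}:=d_\infty(z,A)=\inf_{a\in A}\|z-a\|_\infty$ ($\|\cdot\|_\infty$ the maximum norm), and $$K_{A,z}:=\left\{\sum_{i=1}^{p}\lambda_i\left(z+r_{A,z}e_i\right):\lambda_i>0\text{ for }i\in I_+(z),\ \lambda_i\ge 0\text{ for }i\in\{1,\dots,p\}\setminus I_+(z)\right\}\cup\{0\}.$$ For $A\in\mathcal{A}$ and $(x,y)\in(\mathbb{R}_+^n\times\mathbb{R}_+^m)\setminus A$, the mapping $E_{A,(x,y)}:\mathbb{R}_+^n\rightrightarrows\mathbb{R}_+^m$ is defined by $$gr(E_{A,(x,y)}):=(\mathbb{R}_+^n\times\mathbb{R}_+^m)\setminus\left((x,y)+K_{A,(x,y)}\setminus\{(0,0)\}+(-\mathbb{R}_+^n)\times\mathbb{R}_+^m\right),$$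 where $(x,y)+K_{A,(x,y)}\setminus\{(0,0)\}$ means $(x,y)+\left(K_{A,(x,y)}\setminus\{(0,0)\}\right)$. *)

theory Defs
  imports "HOL-Analysis.Analysis" "HOL-Library.Set_Algebras"
begin

(* The order is the componentwise one of ordered_euclidean_space.  The space R^p with p = n + m
   is the product type real^'n \<times> real^'m, whose Basis consists of the unit vectors
   e_1, ..., e_p.  Sums of sets are Minkowski sums.  Unary and binary minus on sets mean
   complement and set difference in the library, so -C in the algebraic sense is written
   uminus ` C. *)

definition orthant :: "'a::ordered_euclidean_space set" where
  "orthant = {x. 0 \<le> x}"

(* A mapping from orthant to subsets of orthant is a total HOL function F;
   only its values on orthant matter. *)

definition gr :: "('a::ordered_euclidean_space \<Rightarrow> 'b::ordered_euclidean_space set) \<Rightarrow> ('a \<times> 'b) set" where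
  "gr F = {(x, y). x \<in> orthant \<and> y \<in> orthant \<and> y \<in> F x}"

definition increasing :: "('a::ordered_euclidean_space \<Rightarrow> 'b set) \<Rightarrow> bool" where
  "increasing F \<longleftrightarrow> (\<forall>x\<in>orthant. \<forall>y\<in>orthant. x \<le> y \<longrightarrow> F x \<subseteq> F y)"

definition co_radiant ::
  "('a::ordered_euclidean_space \<Rightarrow> 'b::ordered_euclidean_space set) \<Rightarrow> bool" where
  "co_radiant F \<longleftrightarrow> gr F \<noteq> {} \<and>
     (\<forall>x\<in>orthant. \<forall>t\<in>{0<..1}. (*\<^sub>R) t ` F x \<subseteq> F (t *\<^sub>R x))"

definition ICR ::
  "('a::ordered_euclidean_space \<Rightarrow> 'b::ordered_euclidean_space set) \<Rightarrow> bool" where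
  "ICR F \<longleftrightarrow> increasing F \<and> co_radiant F"

definition normal_set :: "'a::ordered_euclidean_space set \<Rightarrow> bool" where
  "normal_set C \<longleftrightarrow> C \<subseteq> orthant \<and> (\<forall>x\<in>C. \<forall>y. 0 \<le> y \<and> y \<le> x \<longrightarrow> y \<in> C)"

definition radiant :: "'a::ordered_euclidean_space set \<Rightarrow> bool" where
  "radiant C \<longleftrightarrow> C \<noteq> {} \<and> C \<subseteq> orthant \<and> (\<forall>x\<in>C. \<forall>t\<in>{0<..1}. t *\<^sub>R x \<in> C)"

definition class_A :: "((real^'n) \<times> (real^'m)) set set" where
  "class_A = {A. A \<noteq> {} \<and> A \<subseteq> orthant \<times> orthant \<and> closed A \<and> radiant A \<and>
     A + orthant \<times> {0} = A \<and>
     (A + {0} \<times> (uminus ` orthant)) \<inter> (orthant \<times> orthant) = A}"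

(* infnorm is the maximum norm with respect to Basis. *)
definition rdist :: "'a::ordered_euclidean_space set \<Rightarrow> 'a \<Rightarrow> real" where
  "rdist A z = (INF a\<in>A. infnorm (z - a))"

definition Kcone :: "'a::ordered_euclidean_space set \<Rightarrow> 'a \<Rightarrow> 'a set" where
  "Kcone A z =
     {(\<Sum>e\<in>Basis. l e *\<^sub>R (z + rdist A z *\<^sub>R e)) | l :: 'a \<Rightarrow> real.
        \<forall>e\<in>Basis. (z \<bullet> e > 0 \<longrightarrow> l e > 0) \<and> (\<not> z \<bullet> e > 0 \<longrightarrow> l e \<ge> 0)} \<union> {0}"

(* The section at u of the set prescribed as the graph. *)
definition Emap ::
  "((real^'n) \<times> (real^'m)) set \<Rightarrow> (real^'n) \<times> (real^'m) \<Rightarrow> real^'n \<Rightarrow> (real^'m) set" where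
  "Emap A z u = {v. (u, v) \<in> (orthant \<times> orthant) -
     ({z} + (Kcone A z - {0}) + (uminus ` orthant) \<times> orthant)}"

lemma gr_Emap:
  "gr (Emap A z) = (orthant \<times> orthant) -
     ({z} + (Kcone A z - {0}) + (uminus ` orthant) \<times> orthant)"
  by (auto simp: gr_def Emap_def)

(* The intersection is taken inside orthant, so the empty family gives the constant value orthant;
   this changes nothing for nonempty families, as all values of Emap lie in orthant. *)
definition Emeet ::
  "((real^'n) \<times> (real^'m)) set \<Rightarrow> real^'n \<Rightarrow> (real^'m) set" where
  "Emeet A u = orthant \<inter> (\<Inter>z\<in>orthant \<times> orthant - A. Emap A z u)"

end

theory Submission
  imports Defs
begin

text \<open>
  Everything rests on the fact that a set \<open>A\<close> of the class \<^const>\<open>class_A\<close> is recovered from the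
  mappings \<open>Emap A z\<close> that it generates: \<open>Emeet A u\<close> is the section of \<open>A\<close> at \<open>u\<close>
  (lemma \<open>mem_Emeet_iff\<close>).  In terms of graphs, the sets
  \<open>z + (K - {0}) + (- orthant) \<times> orthant\<close>, with \<open>z\<close> in the orthant but outside \<open>A\<close> and
  \<open>K = Kcone A z\<close>, miss \<open>A\<close> and together contain all other points of the orthant.

  No such set meets \<open>A\<close>.  As \<open>A\<close> is stable under increasing the first and decreasing the second
  component, the summand \<open>(- orthant) \<times> orthant\<close> can be cancelled, and it remains to see that
  \<open>z + k\<close> is not in \<open>A\<close> for nonzero \<open>k\<close> in \<open>K\<close>.  With \<open>r = rdist A z\<close> and coefficients \<open>l\<close> of sum
  \<open>s > 0\<close> one has \<open>z + k = (1 + s) z + r l\<close>.  If this point were in \<open>A\<close>, radiantness would put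
  \<open>z + r l / (1 + s)\<close> in \<open>A\<close>; but in the maximum norm this point is closer to \<open>z\<close> than the distance
  \<open>r\<close> of \<open>z\<close> from \<open>A\<close> (lemma \<open>add_Kcone_notin\<close>).

  Every point \<open>z\<close> outside \<open>A\<close> is covered.  As \<open>A\<close> is closed, some \<open>w = (1 - \<epsilon>) z\<close> is still outside
  \<open>A\<close>, and the positive multiple \<open>\<epsilon> z\<close> of \<open>z\<close> lies in the cone at \<open>w\<close>: choosing coefficients
  proportional to the coordinates of \<open>z\<close> makes the combination a multiple of \<open>z\<close>
  (lemma \<open>scaleR_mem_Kcone\<close>).

  The theorem follows, since the properties of \<open>F\<close> translate one by one into those that define
  \<^const>\<open>class_A\<close>: monotonicity into stability under \<open>orthant \<times> {0}\<close>, normality of the values into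
  stability under \<open>{0} \<times> (- orthant)\<close>, and co-radiantness into radiantness of the graph.
\<close>

lemma orthant_iff: "x \<in> orthant \<longleftrightarrow> (\<forall>e\<in>Basis. 0 \<le> x \<bullet> e)"
  by (simp add: orthant_def eucl_le[where 'a='a])

lemma orthant_prod: "orthant = orthant \<times> orthant"
  by (auto simp: orthant_def less_eq_prod_def)

lemma mem_uminus_orthant: "x \<in> uminus ` orthant \<longleftrightarrow> x \<le> 0"
proof
  assume "x \<le> 0"
  then have "- x \<in> orthant" by (simp add: orthant_def)
  then show "x \<in> uminus ` orthant" by (rule rev_image_eqI) simp
qed (auto simp: orthant_def)

lemma rdist_nonneg: "A \<noteq> {} \<Longrightarrow> 0 \<le> rdist A z"
  unfolding rdist_def by (rule cINF_greatest) (auto simp: infnorm_pos_le)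

lemma rdist_le: "a \<in> A \<Longrightarrow> rdist A z \<le> infnorm (z - a)"
  unfolding rdist_def by (rule cINF_lower) (auto intro!: bdd_belowI[where m=0] simp: infnorm_pos_le)

lemma infnorm_lessI:
  fixes x :: "'a::euclidean_space"
  assumes "\<And>e. e \<in> Basis \<Longrightarrow> \<bar>x \<bullet> e\<bar> < r"
  shows "infnorm x < r"
  using assms by (subst infnorm_Max) (simp add: Max_less_iff)

lemma inner_sum_Basis_shift:
  fixes z :: "'a::euclidean_space"
  assumes "e \<in> Basis"
  shows "(\<Sum>i\<in>Basis. l i *\<^sub>R (z + r *\<^sub>R i)) \<bullet> e = sum l Basis * (z \<bullet> e) + r * l e"
proof -
  have "(\<Sum>i\<in>Basis. l i *\<^sub>R (z + r *\<^sub>R i)) \<bullet> e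
      = (\<Sum>i\<in>Basis. l i * (z \<bullet> e) + (if i = e then r * l e else 0))"
    unfolding inner_sum_left using assms
    by (intro sum.cong) (auto simp: inner_add_left inner_Basis algebra_simps)
  also have "\<dots> = sum l Basis * (z \<bullet> e) + r * l e"
    using assms by (simp add: sum.distrib sum_distrib_right)
  finally show ?thesis .
qed

lemma KconeE:
  assumes "k \<in> Kcone A z - {0}"
  obtains l where "\<And>e. e \<in> Basis \<Longrightarrow> 0 \<le> l e" and "0 < sum l Basis"
    and "\<And>e. e \<in> Basis \<Longrightarrow> k \<bullet> e = sum l Basis * (z \<bullet> e) + rdist A z * l e"
proof -
  obtain l where k: "k = (\<Sum>e\<in>Basis. l e *\<^sub>R (z + rdist A z *\<^sub>R e))"
    and l: "\<forall>e\<in>Basis. (z \<bullet> e > 0 \<longrightarrow> l e > 0) \<and> (\<not> z \<bullet> e > 0 \<longrightarrow> l e \<ge> 0)"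
    using assms unfolding Kcone_def by blast
  have nn: "0 \<le> l e" if "e \<in> Basis" for e
    using bspec[OF l that] by (metis less_imp_le)
  have "sum l Basis \<noteq> 0"
  proof
    assume "sum l Basis = 0"
    then have "\<forall>e\<in>Basis. l e = 0" using nn by (simp add: sum_nonneg_eq_0_iff)
    then have "k = 0" unfolding k by simp
    then show False using assms by simp
  qed
  moreover have "0 \<le> sum l Basis" using nn by (rule sum_nonneg)
  ultimately show thesis
    by (intro that[of l]) (simp_all add: nn k inner_sum_Basis_shift)
qed

lemma add_Kcone_orthant:
  assumes "A \<noteq> {}" "z \<in> orthant" "k \<in> Kcone A z - {0}"
  shows "z + k \<in> orthant"
  using assms(3)
proof (rule KconeE)
  fix l
  assume "\<And>e. e \<in> Basis \<Longrightarrow> 0 \<le> l e" "0 < sum l Basis"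
    and "\<And>e. e \<in> Basis \<Longrightarrow> k \<bullet> e = sum l Basis * (z \<bullet> e) + rdist A z * l e"
  then show ?thesis
    using assms(2) rdist_nonneg[OF assms(1), of z]
    by (auto simp: orthant_iff inner_add_left intro!: add_nonneg_nonneg)
qed

text \<open>
  Scaling \<open>z + k\<close> back by \<open>1 / (1 + s)\<close>, with \<open>s\<close> the sum of the coefficients, gives a point whose
  distance from \<open>z\<close> is at most \<open>s / (1 + s)\<close> times the distance of \<open>z\<close> from \<open>A\<close>.
\<close>

lemma add_Kcone_notin:
  assumes A: "radiant A" and z: "z \<notin> A" and k: "k \<in> Kcone A z - {0}"
  shows "z + k \<notin> A"
proof
  assume zk: "z + k \<in> A"
  define r where "r = rdist A z"
  obtain l where l: "\<And>e. e \<in> Basis \<Longrightarrow> 0 \<le> l e" and s: "0 < sum l Basis"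
    and ke: "\<And>e. e \<in> Basis \<Longrightarrow> k \<bullet> e = sum l Basis * (z \<bullet> e) + r * l e"
    using KconeE[OF k] unfolding r_def by metis
  define s where "s = sum l Basis"
  define a where "a = (1 / (1 + s)) *\<^sub>R (z + k)"
  have s0: "0 < s" using s by (simp add: s_def)
  have aA: "a \<in> A" using A zk s0 unfolding radiant_def a_def by auto
  have diff: "(z - a) \<bullet> e = - (r * l e / (1 + s))" if "e \<in> Basis" for e
  proof -
    have "(z + k) \<bullet> e = (1 + s) * (z \<bullet> e) + r * l e"
      using ke[OF that] by (simp add: s_def inner_add_left algebra_simps)
    then have "a \<bullet> e = z \<bullet> e + r * l e / (1 + s)"
      using s0 by (simp add: a_def add_divide_distrib)
    then show ?thesis by (simp add: inner_diff_left)
  qed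
  have "r \<noteq> 0"
  proof
    assume "r = 0"
    then have "z = a" using diff by (auto intro!: euclidean_eqI[where 'a='a] simp: inner_diff_left)
    then show False using aA z by simp
  qed
  moreover have "0 \<le> r" using aA unfolding r_def by (intro rdist_nonneg) auto
  ultimately have r: "0 < r" by simp
  have "infnorm (z - a) < r"
  proof (rule infnorm_lessI)
    fix e :: 'a assume e: "e \<in> Basis"
    have "l e \<le> s" unfolding s_def using e l by (intro member_le_sum) auto
    then have "r * l e < r * (1 + s)" using r by simp
    then show "\<bar>(z - a) \<bullet> e\<bar> < r"
      using r s0 l[OF e] by (simp add: diff[OF e] abs_mult field_simps)
  qed
  then show False using rdist_le[OF aA, of z] by (simp add: r_def)
qed

lemma scaleR_mem_Kcone:
  assumes A: "A \<noteq> {}" and w: "w \<in> orthant" "w \<noteq> 0" and d: "0 < d"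
  shows "d *\<^sub>R w \<in> Kcone A w"
proof -
  define r where "r = rdist A w"
  define n where "n = (\<Sum>e\<in>Basis. w \<bullet> e)"
  have we: "0 \<le> w \<bullet> e" if "e \<in> Basis" for e using w that by (simp add: orthant_iff)
  have "n \<noteq> 0"
    using we w(2) unfolding n_def by (auto simp: sum_nonneg_eq_0_iff euclidean_all_zero_iff)
  moreover have "0 \<le> n" unfolding n_def using we by (rule sum_nonneg)
  ultimately have n: "0 < n" by simp
  have r: "0 \<le> r" unfolding r_def using A by (rule rdist_nonneg)
  define c where "c = d / (n + r)"
  have c: "0 < c" using n r d by (simp add: c_def)
  \<comment> \<open>Coefficients \<open>c w\<^sub>e\<close> give the combination \<open>c (n + r) w\<close>, so \<open>c\<close> has to be \<open>d / (n + r)\<close>.\<close>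
  have "(\<Sum>e\<in>Basis. (c * (w \<bullet> e)) *\<^sub>R (w + r *\<^sub>R e)) = d *\<^sub>R w"
  proof (rule euclidean_eqI)
    fix b :: 'a assume b: "b \<in> Basis"
    have "(\<Sum>e\<in>Basis. c * (w \<bullet> e)) = c * n" by (simp add: n_def sum_distrib_left)
    then have "(\<Sum>e\<in>Basis. (c * (w \<bullet> e)) *\<^sub>R (w + r *\<^sub>R e)) \<bullet> b = c * (n + r) * (w \<bullet> b)"
      unfolding inner_sum_Basis_shift[OF b] by (simp add: algebra_simps)
    then show "(\<Sum>e\<in>Basis. (c * (w \<bullet> e)) *\<^sub>R (w + r *\<^sub>R e)) \<bullet> b = d *\<^sub>R w \<bullet> b"
      using n r by (simp add: c_def)
  qed
  moreover have "\<forall>e\<in>Basis. (w \<bullet> e > 0 \<longrightarrow> c * (w \<bullet> e) > 0) \<and> (\<not> w \<bullet> e > 0 \<longrightarrow> c * (w \<bullet> e) \<ge> 0)"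
    using c we by auto
  ultimately show ?thesis unfolding Kcone_def r_def
    by (intro UnI1 CollectI exI[of _ "\<lambda>e. c * (w \<bullet> e)"] conjI) auto
qed

lemma scaleR_one_minus_inverse_Suc_tendsto:
  fixes z :: "'a::real_normed_vector"
  shows "(\<lambda>n. (1 - inverse (real (Suc n))) *\<^sub>R z) \<longlonglongrightarrow> z"
  using tendsto_scaleR[OF tendsto_diff[OF tendsto_const[of 1] LIMSEQ_inverse_real_of_nat] tendsto_const[of z]]
  by simp

lemma zero_mem_closed_radiant:
  assumes "closed A" "radiant A"
  shows "0 \<in> A"
proof -
  obtain a where a: "a \<in> A" using assms(2) by (auto simp: radiant_def)
  have "inverse (real (Suc n)) *\<^sub>R a \<in> A" for n
    using assms(2) a by (auto simp: radiant_def field_simps)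
  moreover have "(\<lambda>n. inverse (real (Suc n)) *\<^sub>R a) \<longlonglongrightarrow> 0"
    using tendsto_scaleR[OF LIMSEQ_inverse_real_of_nat tendsto_const[of a]] by simp
  ultimately show ?thesis by (rule closed_sequentially[OF assms(1)])
qed

text \<open>
  Being closed, \<open>A\<close> misses a point \<open>w\<close> of the segment from \<open>0\<close> to \<open>z\<close> strictly before \<open>z\<close>, and then
  \<open>z - w\<close> is a positive multiple of \<open>w\<close>.  Radiantness enters through \<open>0 \<in> A\<close>, which makes \<open>w\<close>
  nonzero.
\<close>

lemma notin_mem_shifted_Kcone:
  assumes A: "closed A" "radiant A" and z: "z \<in> orthant" "z \<notin> A"
  obtains w where "w \<in> orthant" "w \<notin> A" "z - w \<in> Kcone A w - {0}"
proof -
  obtain n where n: "(1 - inverse (real (Suc n))) *\<^sub>R z \<notin> A"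
    using closed_sequentially[OF A(1) _ scaleR_one_minus_inverse_Suc_tendsto] z(2) by blast
  define t where "t = 1 - inverse (real (Suc n))"
  define w where "w = t *\<^sub>R z"
  have wA: "w \<notin> A" using n by (simp add: w_def t_def)
  have w0: "w \<noteq> 0" using zero_mem_closed_radiant[OF A] wA by metis
  have "0 \<le> t" "t \<noteq> 0" "t < 1" using w0 by (auto simp: w_def t_def field_simps)
  then have t: "0 < t" "t < 1" by auto
  have wo: "w \<in> orthant" using z t by (simp add: w_def orthant_iff)
  have "z - w = ((1 - t) / t) *\<^sub>R w" using t by (simp add: w_def scaleR_diff_left)
  moreover have "((1 - t) / t) *\<^sub>R w \<noteq> 0" using t w0 by simp
  moreover have "((1 - t) / t) *\<^sub>R w \<in> Kcone A w"
    using A(2) wo w0 t by (intro scaleR_mem_Kcone) (auto simp: radiant_def)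
  ultimately show thesis using that[OF wo wA] by simp
qed

lemma class_A_increase:
  assumes "A \<in> class_A" "(x, y) \<in> A" "x \<le> x'"
  shows "(x', y) \<in> A"
proof -
  have "(x, y) + (x' - x, 0) \<in> A + orthant \<times> {0}"
    using assms by (intro set_plus_intro) (auto simp: orthant_def)
  then show ?thesis using assms(1) by (simp add: class_A_def)
qed

lemma class_A_decrease:
  assumes "A \<in> class_A" "(x, y) \<in> A" "0 \<le> y'" "y' \<le> y"
  shows "(x, y') \<in> A"
proof -
  have "(x, y) + (0, - (y - y')) \<in> A + {0} \<times> (uminus ` orthant)"
    using assms by (intro set_plus_intro) (auto simp: mem_uminus_orthant)
  moreover have "(x, y') \<in> orthant \<times> orthant"
    using assms by (auto simp: class_A_def orthant_def)
  ultimately have "(x, y') \<in> (A + {0} \<times> (uminus ` orthant)) \<inter> (orthant \<times> orthant)" by simp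
  then show ?thesis using assms(1) unfolding class_A_def by blast
qed

lemma mem_Emeet_iff:
  fixes A :: "((real^'n) \<times> (real^'m)) set"
  assumes A: "A \<in> class_A" and u: "u \<in> orthant"
  shows "v \<in> Emeet A u \<longleftrightarrow> (u, v) \<in> A"
proof
  have Ac: "closed A" and Ar: "radiant A" and Ao: "A \<subseteq> orthant \<times> orthant" and Ane: "A \<noteq> {}"
    using A by (auto simp: class_A_def)
  {
    assume uv: "(u, v) \<in> A"
    have "(u, v) \<notin> {z} + (Kcone A z - {0}) + (uminus ` orthant) \<times> orthant"
      if z: "z \<in> orthant \<times> orthant" "z \<notin> A" for z
    proof
      assume "(u, v) \<in> {z} + (Kcone A z - {0}) + (uminus ` orthant) \<times> orthant"
      then obtain k c where k: "k \<in> Kcone A z - {0}" and eq: "(u, v) = z + k + c"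
        and "c \<in> (uminus ` orthant) \<times> orthant"
        by (blast elim: set_plus_elim)
      then obtain a b where ab: "c = (a, b)" "a \<le> 0" "0 \<le> b"
        by (cases c) (auto simp: mem_uminus_orthant orthant_def)
      have "z + k \<in> orthant" using add_Kcone_orthant[OF Ane _ k] z by (simp add: orthant_prod)
      then obtain p q where pq: "z + k = (p, q)" "0 \<le> q"
        by (cases "z + k") (auto simp: orthant_prod orthant_def)
      have "u \<le> p" "q \<le> v" using eq ab unfolding pq(1) by auto
      then have "(p, q) \<in> A" using class_A_decrease[OF A class_A_increase[OF A uv]] pq(2) by blast
      then show False using add_Kcone_notin[OF Ar z(2) k] pq(1) by simp
    qed
    then show "v \<in> Emeet A u" using uv Ao by (auto simp: Emeet_def Emap_def)
  next
    assume v: "v \<in> Emeet A u"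
    show "(u, v) \<in> A"
    proof (rule ccontr)
      assume uv: "(u, v) \<notin> A"
      have "v \<in> orthant" using v by (simp add: Emeet_def)
      then have "(u, v) \<in> orthant" using u by (simp add: orthant_prod)
      then obtain w where w: "w \<in> orthant" "w \<notin> A" "(u, v) - w \<in> Kcone A w - {0}"
        using notin_mem_shifted_Kcone[OF Ac Ar _ uv] by metis
      have "w + ((u, v) - w) + (0, 0) \<in> {w} + (Kcone A w - {0}) + (uminus ` orthant) \<times> orthant"
        using w(3) by (intro set_plus_intro) (auto simp: mem_uminus_orthant orthant_def)
      then have "v \<notin> Emap A w u" by (simp add: Emap_def)
      then show False using v w by (auto simp: Emeet_def orthant_prod)
    qed
  }
qed

lemma gr_mem_class_A:
  fixes F :: "real^'n \<Rightarrow> (real^'m) set"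
  assumes "ICR F" and normal: "\<forall>x\<in>orthant. normal_set (F x)" and "closed (gr F)"
  shows "gr F \<in> class_A"
proof -
  have inc: "F x \<subseteq> F y" if "0 \<le> x" "x \<le> y" for x y
    using assms(1) that by (auto simp: ICR_def increasing_def orthant_def)
  have cor: "t *\<^sub>R v \<in> F (t *\<^sub>R x)" if "x \<in> orthant" "v \<in> F x" "t \<in> {0<..1}" for t x v
    using assms(1) that unfolding ICR_def co_radiant_def by blast
  have ne: "gr F \<noteq> {}" using assms(1) by (simp add: ICR_def co_radiant_def)
  have sub: "gr F \<subseteq> orthant \<times> orthant" by (auto simp: gr_def)
  have "radiant (gr F)"
    unfolding radiant_def
  proof (intro conjI ballI)
    show "gr F \<noteq> {}" by (rule ne)
    show "gr F \<subseteq> orthant" using sub by (simp add: orthant_prod)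
    fix p and t :: real assume p: "p \<in> gr F" and t: "t \<in> {0<..1}"
    obtain x v where xv: "p = (x, v)" "x \<in> orthant" "v \<in> orthant" "v \<in> F x"
      using p by (auto simp: gr_def)
    have "t *\<^sub>R x \<in> orthant" "t *\<^sub>R v \<in> orthant" using xv t by (simp_all add: orthant_iff)
    then show "t *\<^sub>R p \<in> gr F" using cor[OF xv(2,4) t] xv(1) by (simp add: gr_def)
  qed
  moreover have "gr F + orthant \<times> {0} = gr F"
  proof
    show "gr F + orthant \<times> {0} \<subseteq> gr F"
    proof
      fix p assume "p \<in> gr F + orthant \<times> {0}"
      then obtain x y d where "(x, y) \<in> gr F" "0 \<le> d" "p = (x + d, y)"
        by (auto simp: set_plus_def orthant_def)
      then show "p \<in> gr F"
        using inc[of x "x + d"] by (auto simp: gr_def orthant_def)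
    qed
    show "gr F \<subseteq> gr F + orthant \<times> {0}"
    proof
      fix p assume "p \<in> gr F"
      then have "p + 0 \<in> gr F + orthant \<times> {0}"
        by (intro set_plus_intro) (auto simp: orthant_def zero_prod_def)
      then show "p \<in> gr F + orthant \<times> {0}" by simp
    qed
  qed
  moreover have "(gr F + {0} \<times> (uminus ` orthant)) \<inter> (orthant \<times> orthant) = gr F"
  proof
    show "(gr F + {0} \<times> (uminus ` orthant)) \<inter> (orthant \<times> orthant) \<subseteq> gr F"
    proof
      fix p assume p: "p \<in> (gr F + {0} \<times> (uminus ` orthant)) \<inter> (orthant \<times> orthant)"
      then obtain x y d where "(x, y) \<in> gr F" "0 \<le> d" "p = (x, y - d)"
        by (auto simp: set_plus_def orthant_def)
      then show "p \<in> gr F"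
        using p normal by (auto simp: gr_def normal_set_def orthant_def)
    qed
    show "gr F \<subseteq> (gr F + {0} \<times> (uminus ` orthant)) \<inter> (orthant \<times> orthant)"
    proof
      fix p assume p: "p \<in> gr F"
      then have "p + 0 \<in> gr F + {0} \<times> (uminus ` orthant)"
        by (intro set_plus_intro) (auto simp: orthant_def zero_prod_def)
      then show "p \<in> (gr F + {0} \<times> (uminus ` orthant)) \<inter> (orthant \<times> orthant)"
        using p sub by auto
    qed
  qed
  ultimately show ?thesis using ne sub assms(3) by (simp add: class_A_def)
qed

lemma sections_of_class_A:
  fixes F :: "real^'n \<Rightarrow> (real^'m) set"
  assumes A: "A \<in> class_A" and F: "\<And>u v. u \<in> orthant \<Longrightarrow> v \<in> F u \<longleftrightarrow> (u, v) \<in> A"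
  shows "ICR F \<and> (\<forall>x\<in>orthant. normal_set (F x)) \<and> closed (gr F)"
proof (intro conjI)
  have Ao: "A \<subseteq> orthant \<times> orthant" using A by (simp add: class_A_def)
  have gr: "gr F = A" using F Ao by (auto simp: gr_def)
  have scale: "t *\<^sub>R a \<in> A" if "a \<in> A" "0 < t" "t \<le> 1" for a t
    using A that by (auto simp: class_A_def radiant_def)
  have "increasing F" unfolding increasing_def
    using F class_A_increase[OF A] by blast
  moreover have "co_radiant F" unfolding co_radiant_def
  proof (intro conjI ballI)
    show "gr F \<noteq> {}" using A gr by (simp add: class_A_def)
    fix x :: "real^'n" and t :: real assume x: "x \<in> orthant" and t: "t \<in> {0<..1}"
    have "t *\<^sub>R x \<in> orthant" using x t by (simp add: orthant_iff)
    then show "(*\<^sub>R) t ` F x \<subseteq> F (t *\<^sub>R x)"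
      using F x t scale[of "(x, _)" t] by auto
  qed
  ultimately show "ICR F" by (simp add: ICR_def)
  show "\<forall>x\<in>orthant. normal_set (F x)"
    using F Ao class_A_decrease[OF A] unfolding normal_set_def by blast
  show "closed (gr F)" using A gr by (simp add: class_A_def)
qed

theorem theorem34:
  fixes F :: "real^'n \<Rightarrow> (real^'m) set"
  assumes "\<forall>x\<in>orthant. F x \<subseteq> orthant"
  shows "(ICR F \<and> (\<forall>x\<in>orthant. normal_set (F x)) \<and> closed (gr F) \<longleftrightarrow>
            (\<exists>A\<in>class_A. \<forall>u\<in>orthant. F u = Emeet A u)) \<and>
         (ICR F \<and> (\<forall>x\<in>orthant. normal_set (F x)) \<and> closed (gr F) \<longrightarrow>
            gr F \<in> class_A \<and> (\<forall>u\<in>orthant. F u = Emeet (gr F) u))"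
proof -
  have namely: "gr F \<in> class_A \<and> (\<forall>u\<in>orthant. F u = Emeet (gr F) u)"
    if "ICR F \<and> (\<forall>x\<in>orthant. normal_set (F x)) \<and> closed (gr F)"
  proof -
    have "gr F \<in> class_A" using that gr_mem_class_A by blast
    moreover have "v \<in> F u \<longleftrightarrow> (u, v) \<in> gr F" if "u \<in> orthant" for u v
      using assms that by (auto simp: gr_def)
    ultimately show ?thesis using mem_Emeet_iff by blast
  qed
  have "ICR F \<and> (\<forall>x\<in>orthant. normal_set (F x)) \<and> closed (gr F)"
    if "A \<in> class_A" "\<forall>u\<in>orthant. F u = Emeet A u" for A
    using that by (intro sections_of_class_A[of A]) (simp_all add: mem_Emeet_iff)
  with namely show ?thesis by blast
qed

end
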